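(* (Straight semi-continuous limit of the one-component C3 lattice equation, by formal expansion.) Consider the lattice equation, on a $3\times3$ stencil centred at the origin, $$\frac{(x_{1,1}-x_{0,1})(x_{-1,1}-x_{0,0})(x_{-1,0}-x_{-1,-1})}{(x_{1,1}-x_{1,0})(x_{0,0}-x_{1,-1})(x_{0,-1}-x_{-1,-1})}=\frac{M_1}{M_2},$$ $$M_1=(x_{0,0}-x_{-1,1})(b_0x_{-1,0}+b_1)+(x_{0,1}-x_{-1,1})(x_{-1,0}-x_{0,0})P-(x_{0,1}-x_{0,0})(x_{-1,0}-x_{-1,1})Q,$$ $$M_2=(x_{1,-1}-x_{0,0})(b_0x_{0,-1}+b_1)+(x_{1,0}-x_{0,0})(x_{0,-1}-x_{1,-1})P-(x_{1,0}-x_{1,-1})(x_{0,-1}-x_{0,0})Q.$$ Let $P=P(p)$ and $Q=P(q)$, where $P(s)=g_3(s)$ or $P(s)=g_3(s)-g_3(a)$ with $g_3(s)=s^3+\alpha_2s^2+\alpha_1s+\alpha_0$. Without any gauge transformation, substitute $x_{\nu,\mu}=u_\nu(\xi+\epsilon\mu)$, $\nu,\mu\in\{-1,0,1\}$, with $\epsilon=1/q$, and expand formally in $\epsilon$ as $q\to\infty$. The leading term in the expansion is $$\partial_\xi\log\left[P(p)(u_1-u_{-1})-b_1-b_0u_{-1}+\frac{u_1'u_0'u_{-1}'}{(u_1-u_0)(u_0-u_{-1})}\right]=\frac{u_1'}{u_1-u_0}-\frac{u_{-1}'}{u_0-u_{-1}}.$$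
   Context: Here $x_{\nu,\mu}$ denotes the value of the dependent variable $x$ at the lattice point shifted by $(\nu,\mu)$, $u_\nu=u_\nu(\xi)$, and primes denote derivatives with respect to the continuous variable $\xi$. The lattice equation is the one-component form (in the variable $x$) of the C3 lattice Boussinesq system; $p,q$ are lattice parameters, and $a,b_0,b_1,\alpha_0,\alpha_1,\alpha_2$ are constants. The derivation is a formal expansion. *)

theory Defs
  imports
    "HOL-Analysis.Analysis"
    "HOL-Computational_Algebra.Formal_Laurent_Series"
begin

text \<open>
  A stencil is a function \<open>x\<close> with \<open>x \<nu> \<mu>\<close> the value of the dependent variable at the lattice
  point shifted by \<open>(\<nu>, \<mu>)\<close>. The lattice equation is written over an arbitrary field, so that it
  can be evaluated on formal Laurent series in \<open>\<epsilon>\<close>.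
\<close>

definition C3_quotient :: "(int \<Rightarrow> int \<Rightarrow> 'b::field) \<Rightarrow> 'b" where
  "C3_quotient x =
     ((x 1 1 - x 0 1) * (x (-1) 1 - x 0 0) * (x (-1) 0 - x (-1) (-1))) /
     ((x 1 1 - x 1 0) * (x 0 0 - x 1 (-1)) * (x 0 (-1) - x (-1) (-1)))"

definition C3_M1 :: "'b::field \<Rightarrow> 'b \<Rightarrow> 'b \<Rightarrow> 'b \<Rightarrow> (int \<Rightarrow> int \<Rightarrow> 'b) \<Rightarrow> 'b" where
  "C3_M1 b0 b1 P Q x =
     (x 0 0 - x (-1) 1) * (b0 * x (-1) 0 + b1)
     + (x 0 1 - x (-1) 1) * (x (-1) 0 - x 0 0) * P
     - (x 0 1 - x 0 0) * (x (-1) 0 - x (-1) 1) * Q"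

definition C3_M2 :: "'b::field \<Rightarrow> 'b \<Rightarrow> 'b \<Rightarrow> 'b \<Rightarrow> (int \<Rightarrow> int \<Rightarrow> 'b) \<Rightarrow> 'b" where
  "C3_M2 b0 b1 P Q x =
     (x 1 (-1) - x 0 0) * (b0 * x 0 (-1) + b1)
     + (x 1 0 - x 0 0) * (x 0 (-1) - x 1 (-1)) * P
     - (x 1 0 - x 1 (-1)) * (x 0 (-1) - x 0 0) * Q"

text \<open>Left-hand side minus right-hand side of the lattice equation.\<close>

definition C3_defect :: "'b::field \<Rightarrow> 'b \<Rightarrow> 'b \<Rightarrow> 'b \<Rightarrow> (int \<Rightarrow> int \<Rightarrow> 'b) \<Rightarrow> 'b" where
  "C3_defect b0 b1 P Q x = C3_quotient x - C3_M1 b0 b1 P Q x / C3_M2 b0 b1 P Q x"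

definition g3 :: "'a::comm_ring_1 \<Rightarrow> 'a \<Rightarrow> 'a \<Rightarrow> 'a poly" where
  "g3 \<alpha>0 \<alpha>1 \<alpha>2 = [:\<alpha>0, \<alpha>1, \<alpha>2, 1:]"

text \<open>
  Formal Taylor series of \<open>f (\<xi> + \<epsilon> \<mu>)\<close> in the indeterminate \<open>\<epsilon> = fls_X\<close>; no convergence is
  required. The class \<open>real_normed_field\<close> covers the real and the complex case.
\<close>

definition shift_series :: "('a::real_normed_field \<Rightarrow> 'a) \<Rightarrow> 'a \<Rightarrow> int \<Rightarrow> 'a fls" where
  "shift_series f \<xi> \<mu> =
     fps_to_fls (Abs_fps (\<lambda>n. (deriv ^^ n) f \<xi> * of_int \<mu> ^ n / fact n))"

text \<open>
  The lattice defect after substituting \<open>x \<nu> \<mu> = u \<nu> (\<xi> + \<epsilon> \<mu>)\<close>, \<open>P = P(p)\<close> and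
  \<open>Q = P(q)\<close> with \<open>q = 1/\<epsilon>\<close>, as a formal Laurent series in \<open>\<epsilon>\<close>.
\<close>

definition straight_expansion ::
  "'a::real_normed_field poly \<Rightarrow> 'a \<Rightarrow> 'a \<Rightarrow> 'a \<Rightarrow> (int \<Rightarrow> 'a \<Rightarrow> 'a) \<Rightarrow> 'a \<Rightarrow> 'a fls" where
  "straight_expansion Pol p b0 b1 u \<xi> =
     C3_defect (fls_const b0) (fls_const b1)
       (fls_const (poly Pol p))
       (poly (map_poly fls_const Pol) (inverse fls_X))
       (\<lambda>\<nu> \<mu>. shift_series (u \<nu>) \<xi> \<mu>)"

text \<open>
  The derivative \<open>\<partial> log f = f' / f\<close>. It is the derivative of every branch of the logarithm
  of \<open>f\<close>, and needs no choice of branch or sign condition; see the two lemmas below.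
\<close>

definition dlog :: "('a::real_normed_field \<Rightarrow> 'a) \<Rightarrow> 'a \<Rightarrow> 'a" where
  "dlog f \<xi> = deriv f \<xi> / f \<xi>"

lemma dlog_branch:
  fixes f L :: "'a::{real_normed_field,banach} \<Rightarrow> 'a"
  assumes L: "(L has_field_derivative d) (at \<xi>)"
    and ev: "\<forall>\<^sub>F \<eta> in nhds \<xi>. exp (L \<eta>) = f \<eta>"
  shows "dlog f \<xi> = d"
proof -
  have "((\<lambda>\<eta>. exp (L \<eta>)) has_field_derivative exp (L \<xi>) * d) (at \<xi>)"
    using DERIV_chain2[OF DERIV_exp L] .
  then have "(f has_field_derivative exp (L \<xi>) * d) (at \<xi>)"
    using DERIV_cong_ev[OF refl ev refl] by blast
  then have "deriv f \<xi> = exp (L \<xi>) * d" by (rule DERIV_imp_deriv)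
  moreover have "f \<xi> = exp (L \<xi>)" using eventually_nhds_x_imp_x[OF ev] by simp
  ultimately show ?thesis by (simp add: dlog_def)
qed

lemma dlog_ln_abs:
  fixes f :: "real \<Rightarrow> real"
  assumes f: "f field_differentiable (at \<xi>)" and nz: "f \<xi> \<noteq> 0"
  shows "deriv (\<lambda>\<eta>. ln \<bar>f \<eta>\<bar>) \<xi> = dlog f \<xi>"
proof -
  have d: "(f has_field_derivative deriv f \<xi>) (at \<xi>)"
    using f by (simp add: DERIV_deriv_iff_field_differentiable)
  have "((\<lambda>\<eta>. ln (f \<eta>)) has_field_derivative deriv f \<xi> / f \<xi>) (at \<xi>)"
  proof (cases "f \<xi> > 0")
    case True
    then show ?thesis using d by (auto intro!: derivative_eq_intros)
  next
    case False
    then have "- f \<xi> > 0" using nz by simp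
    then have "((\<lambda>\<eta>. ln (- f \<eta>)) has_field_derivative deriv f \<xi> / f \<xi>) (at \<xi>)"
      using d by (auto intro!: derivative_eq_intros)
    then show ?thesis by (simp add: ln_minus)
  qed
  moreover have "(\<lambda>\<eta>. ln \<bar>f \<eta>\<bar>) = (\<lambda>\<eta>. ln (f \<eta>))"
    by (auto simp: abs_if ln_minus)
  ultimately show ?thesis by (simp add: dlog_def DERIV_imp_deriv)
qed

definition straight_bracket ::
  "'a::real_normed_field \<Rightarrow> 'a \<Rightarrow> 'a \<Rightarrow> (int \<Rightarrow> 'a \<Rightarrow> 'a) \<Rightarrow> 'a \<Rightarrow> 'a" where
  "straight_bracket Pp b0 b1 u \<xi> =
     Pp * (u 1 \<xi> - u (-1) \<xi>) - b1 - b0 * u (-1) \<xi>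
     + deriv (u 1) \<xi> * deriv (u 0) \<xi> * deriv (u (-1)) \<xi>
       / ((u 1 \<xi> - u 0 \<xi>) * (u 0 \<xi> - u (-1) \<xi>))"

definition straight_rhs :: "(int \<Rightarrow> 'a::real_normed_field \<Rightarrow> 'a) \<Rightarrow> 'a \<Rightarrow> 'a" where
  "straight_rhs u \<xi> =
     deriv (u 1) \<xi> / (u 1 \<xi> - u 0 \<xi>) - deriv (u (-1)) \<xi> / (u 0 \<xi> - u (-1) \<xi>)"

end

(*
  Dividing every difference in the continuous direction by \<epsilon> turns the defect into a quotient
  of formal power series in \<epsilon> whose denominator has a nonzero constant term, since
  \<epsilon>^3 P(1/\<epsilon>) = 1 + \<alpha>2 \<epsilon> + ... . The cross-multiplied numerator vanishes at
  \<epsilon> = 0, and its linear coefficient, from which \<alpha>2 cancels, is the differential equation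
  up to a nonzero factor.
*)

theory Submission
  imports Defs
begin

text \<open>In \<open>C3_quotient\<close> numerator and denominator each contain one difference in
  the continuous direction, so a factor \<open>e\<close> cancels. In \<open>C3_M1\<close> and
  \<open>C3_M2\<close> the coefficient of \<open>Q\<close> contains two such differences;
  multiplying by \<open>e\<close> turns \<open>Q\<close> into the regular quantity
  \<open>R\<close>.\<close>

lemma C3_defect_rescaled:
  fixes e :: "'b::field"
  assumes e: "e \<noteq> 0" and Q: "e ^ 3 * Q = R"
    and Ap: "x 1 1 - x 1 0 = e * dAp" and Am: "x 1 0 - x 1 (-1) = e * dAm"
    and Bp: "x 0 1 - x 0 0 = e * dBp" and Bm: "x 0 0 - x 0 (-1) = e * dBm"
    and Cp: "x (-1) 1 - x (-1) 0 = e * dCp" and Cm: "x (-1) 0 - x (-1) (-1) = e * dCm"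
    and X: "X = (x 1 1 - x 0 1) * (x (-1) 1 - x 0 0) * dCm"
    and Y: "Y = dAp * (x 0 0 - x 1 (-1)) * (x 0 (-1) - x (-1) (-1))"
    and M: "M = e * ((x 0 0 - x (-1) 1) * (b0 * x (-1) 0 + b1)
                 + (x 0 1 - x (-1) 1) * (x (-1) 0 - x 0 0) * P) + dBp * dCp * R"
    and N: "N = e * ((x 1 (-1) - x 0 0) * (b0 * x 0 (-1) + b1)
                 + (x 1 0 - x 0 0) * (x 0 (-1) - x 1 (-1)) * P) + dAm * dBm * R"
    and Y0: "Y \<noteq> 0" and N0: "N \<noteq> 0"
  shows "C3_defect b0 b1 P Q x * (Y * N) = X * N - Y * M"
proof -
  have "C3_quotient x = (e * X) / (e * Y)"
    unfolding C3_quotient_def Ap Cm X Y by (simp add: algebra_simps)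
  then have q: "C3_quotient x = X / Y" using e by simp
  have Cp': "x (-1) 0 - x (-1) 1 = - (e * dCp)" and Bm': "x 0 (-1) - x 0 0 = - (e * dBm)"
    using Cp Bm by (simp_all add: algebra_simps)
  have "e * C3_M1 b0 b1 P Q x = M"
    unfolding C3_M1_def Bp Cp' M Q[symmetric] by (simp add: algebra_simps power3_eq_cube)
  moreover have "e * C3_M2 b0 b1 P Q x = N"
    unfolding C3_M2_def Am Bm' N Q[symmetric] by (simp add: algebra_simps power3_eq_cube)
  ultimately have m: "C3_M1 b0 b1 P Q x / C3_M2 b0 b1 P Q x = M / N"
    using e by (metis mult_divide_mult_cancel_left)
  then show ?thesis
    unfolding C3_defect_def q m using Y0 N0 by (simp add: field_simps)
qed

text \<open>Coefficients are computed in power series; Laurent series serve only for the pole of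
  P(1/\<epsilon>) and for division.\<close>

definition shift_fps :: "('a::real_normed_field \<Rightarrow> 'a) \<Rightarrow> 'a \<Rightarrow> int \<Rightarrow> 'a fps" where
  "shift_fps f \<xi> \<mu> = Abs_fps (\<lambda>n. (deriv ^^ n) f \<xi> * of_int \<mu> ^ n / fact n)"

lemma shift_series_eq: "shift_series f \<xi> \<mu> = fps_to_fls (shift_fps f \<xi> \<mu>)"
  by (simp add: shift_series_def shift_fps_def)

lemma shift_fps_nth_0 [simp]: "fps_nth (shift_fps f \<xi> \<mu>) 0 = f \<xi>"
  by (simp add: shift_fps_def)

lemma shift_fps_nth_1 [simp]: "fps_nth (shift_fps f \<xi> \<mu>) (Suc 0) = deriv f \<xi> * of_int \<mu>"
  by (simp add: shift_fps_def)

lemma shift_fps_nth_2 [simp]: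
  "fps_nth (shift_fps f \<xi> \<mu>) (Suc (Suc 0)) = (deriv ^^ 2) f \<xi> * of_int \<mu> ^ 2 / 2"
  by (simp add: shift_fps_def eval_nat_numeral)

lemma fps_X_mult_shift_diff:
  fixes f g :: "'a::comm_ring_1 fps"
  assumes "fps_nth f 0 = fps_nth g 0"
  shows "f - g = fps_X * fps_shift 1 (f - g)"
  using assms by (simp add: fps_eq_iff fps_X_mult_nth)

text \<open>\<open>H\<close> is a unit among power series, so \<open>D\<close> is the power series
  \<open>G * inverse H\<close>. Since \<open>G\<close> has no constant term, only the constant term
  of \<open>inverse H\<close> enters the linear coefficient.\<close>

lemma fls_quotient_leading_coeffs:
  fixes D :: "'a::field fls"
  assumes D: "D * fps_to_fls H = fps_to_fls G"
    and H: "fps_nth H 0 \<noteq> 0" and G: "fps_nth G 0 = 0"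
  shows "(\<forall>n<1. fls_nth D n = 0) \<and> fls_nth D 1 = fps_nth G 1 / fps_nth H 0"
proof -
  have "H * inverse H = 1" using H by (simp add: inverse_mult_eq_1')
  then have "fps_to_fls H * fps_to_fls (inverse H) = 1"
    by (metis fls_times_fps_to_fls fps_one_to_fls)
  then have "D = fps_to_fls (G * inverse H)"
    using D by (metis fls_times_fps_to_fls mult.assoc mult.right_neutral)
  moreover have "fps_nth (G * inverse H) 0 = 0" using G by simp
  moreover have "fps_nth (G * inverse H) 1 = fps_nth G 1 / fps_nth H 0"
    using G by (simp add: fps_mult_nth_1 divide_inverse)
  \<comment> \<open>\<open>nat\<close> truncates, so this covers the index 0 and the negative
    indices together.\<close>
  moreover have "nat n = 0" if "n < 1" for n :: int using that by simp
  ultimately show ?thesis by auto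
qed

text \<open>Multiplication by the cube reverses the coefficient list, so monicity of the cubic
  becomes constant term 1.\<close>

lemma cubic_at_inverse_fls_X:
  "fls_X ^ 3 * poly (map_poly fls_const [:c0, c1, c2, 1:]) (inverse fls_X)
     = fps_to_fls (Abs_fps (\<lambda>n. if n = 0 then 1 else if n = 1 then c2
         else if n = 2 then c1 else if n = 3 then c0 else (0::'a::field)))"
  (is "_ = fps_to_fls ?R")
proof -
  have R: "?R = 1 + fps_const c2 * fps_X + fps_const c1 * fps_X ^ 2 + fps_const c0 * fps_X ^ 3"
    by (auto simp: fps_eq_iff fps_X_power_nth fps_X_nth)
  define y where "y = inverse (fls_X :: 'a fls)"
  have xy: "fls_X * y = 1" unfolding y_def by (intro right_inverse) simp
  \<comment> \<open>The Horner form produced by \<open>poly\<close>, regrouped so that every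
    \<open>y\<close> meets a factor \<open>fls_X\<close>.\<close>
  have "fls_X ^ 3 * (fls_const c0 + y * (fls_const c1 + y * (fls_const c2 + y * 1)))
      = fls_const c0 * fls_X ^ 3 + (fls_X * y) * fls_const c1 * fls_X ^ 2
        + (fls_X * y) ^ 2 * fls_const c2 * fls_X + (fls_X * y) ^ 3"
    by (simp add: algebra_simps power2_eq_square power3_eq_cube)
  then show ?thesis
    unfolding R xy
    by (simp add: y_def map_poly_pCons fps_to_fls_plus fls_times_fps_to_fls
        fps_to_fls_power algebra_simps)
qed

text \<open>The quotient rule, with the value arranged to match the hypothesis \<open>dW\<close> of
  \<open>leading_coefficient_identity\<close>.\<close>

lemma deriv_straight_bracket:
  assumes d: "\<And>\<nu>. \<nu> \<in> {-1, 0, 1} \<Longrightarrow> u \<nu> field_differentiable (at \<xi>)"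
    "\<And>\<nu>. \<nu> \<in> {-1, 0, 1} \<Longrightarrow> deriv (u \<nu>) field_differentiable (at \<xi>)"
    and "u 1 \<xi> \<noteq> u 0 \<xi>" and "u 0 \<xi> \<noteq> u (-1) \<xi>"
  shows "deriv (straight_bracket Pp b0 b1 u) \<xi> =
    (let a = u 1 \<xi> - u 0 \<xi>; b = u 0 \<xi> - u (-1) \<xi>;
         A1 = deriv (u 1) \<xi>; B1 = deriv (u 0) \<xi>; C1 = deriv (u (-1)) \<xi>;
         A2 = (deriv ^^ 2) (u 1) \<xi>; B2 = (deriv ^^ 2) (u 0) \<xi>; C2 = (deriv ^^ 2) (u (-1)) \<xi>
     in Pp * (A1 - C1) - b0 * C1
        + ((A2 * B1 * C1 + A1 * B2 * C1 + A1 * B1 * C2) * (a * b)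
            - A1 * B1 * C1 * ((A1 - B1) * b + a * (B1 - C1))) / (a * b)\<^sup>2)"
proof -
  have D: "(u \<nu> has_field_derivative deriv (u \<nu>) \<xi>) (at \<xi>)"
    "(deriv (u \<nu>) has_field_derivative (deriv ^^ 2) (u \<nu>) \<xi>) (at \<xi>)" if "\<nu> \<in> {-1, 0, 1}" for \<nu>
    using d[OF that] by (simp_all add: DERIV_deriv_iff_field_differentiable eval_nat_numeral)
  \<comment> \<open>Odd entries of \<open>DD\<close> are first derivatives and even entries second
    ones, in the order \<open>u 1\<close>, \<open>u 0\<close>, \<open>u (-1)\<close>.\<close>
  note DD = D[of 1, simplified] D[of 0, simplified] D[of "-1", simplified]
  have lin: "((\<lambda>\<eta>. Pp * (u 1 \<eta> - u (-1) \<eta>) - b1 - b0 * u (-1) \<eta>)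
      has_field_derivative Pp * (deriv (u 1) \<xi> - deriv (u (-1)) \<xi>) - b0 * deriv (u (-1)) \<xi>) (at \<xi>)"
    by (rule derivative_eq_intros DD refl | simp)+
  have num: "((\<lambda>\<eta>. deriv (u 1) \<eta> * deriv (u 0) \<eta> * deriv (u (-1)) \<eta>)
      has_field_derivative (deriv ^^ 2) (u 1) \<xi> * deriv (u 0) \<xi> * deriv (u (-1)) \<xi>
        + deriv (u 1) \<xi> * (deriv ^^ 2) (u 0) \<xi> * deriv (u (-1)) \<xi>
        + deriv (u 1) \<xi> * deriv (u 0) \<xi> * (deriv ^^ 2) (u (-1)) \<xi>) (at \<xi>)"
    by (rule DERIV_cong[OF DERIV_mult[OF DERIV_mult[OF DD(2) DD(4)] DD(6)]])
       (simp add: algebra_simps)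
  have den: "((\<lambda>\<eta>. (u 1 \<eta> - u 0 \<eta>) * (u 0 \<eta> - u (-1) \<eta>)) has_field_derivative
      (deriv (u 1) \<xi> - deriv (u 0) \<xi>) * (u 0 \<xi> - u (-1) \<xi>)
        + (u 1 \<xi> - u 0 \<xi>) * (deriv (u 0) \<xi> - deriv (u (-1)) \<xi>)) (at \<xi>)"
    by (rule DERIV_cong[OF DERIV_mult[OF DERIV_diff[OF DD(1) DD(3)] DERIV_diff[OF DD(3) DD(5)]]])
       (simp add: algebra_simps)
  show ?thesis
    unfolding straight_bracket_def[abs_def] Let_def power2_eq_square
    using assms(3,4) by (intro DERIV_imp_deriv DERIV_add[OF lin DERIV_divide[OF num den]]) simp
qed

text \<open>
  Here \<open>a = u\<^sub>1 - u\<^sub>0\<close>, \<open>b = u\<^sub>0 - u\<^sub>-\<^sub>1\<close>, \<open>B = u\<^sub>0\<close>, the letters A, B, C followed by a digit are the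
  derivatives of \<open>u\<^sub>1\<close>, \<open>u\<^sub>0\<close>, \<open>u\<^sub>-\<^sub>1\<close>, and \<open>X\<close>, \<open>Y\<close>, \<open>M\<close>, \<open>N\<close> followed by a digit are the
  coefficients of the rescaled series.
\<close>

lemma leading_coefficient_identity:
  fixes a b B A1 B1 C1 A2 B2 C2 Pp b0 b1 \<alpha> W dW :: "'a::field_char_0"
  assumes "a \<noteq> 0" "b \<noteq> 0" "A1 \<noteq> 0" "B1 \<noteq> 0" "W \<noteq> 0"
    and W: "W = Pp * (a + b) - b1 - b0 * (B - b) + A1 * B1 * C1 / (a * b)"
    and dW: "dW = Pp * (A1 - C1) - b0 * C1
        + ((A2 * B1 * C1 + A1 * B2 * C1 + A1 * B1 * C2) * (a * b)
            - A1 * B1 * C1 * ((A1 - B1) * b + a * (B1 - C1))) / (a * b)\<^sup>2"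
    and X0: "X0 = - a * b * C1"
    and X1: "X1 = - ((A1 - B1) * b * C1) + a * C1 * C1 + a * b * C2 / 2"
    and Y0: "Y0 = - a * b * A1"
    and Y1: "Y1 = - (a * b * A2 / 2) + A1 * A1 * b - a * A1 * (C1 - B1)"
    and M0: "M0 = B1 * C1"
    and M1: "M1 = b * (b0 * (B - b) + b1) - b * b * Pp + (B2 / 2 * C1 + B1 * C2 / 2 + B1 * C1 * \<alpha>)"
    and N0: "N0 = A1 * B1"
    and N1: "N1 = a * (b0 * B + b1) - a * a * Pp - (A2 / 2 * B1 + A1 * B2 / 2) + A1 * B1 * \<alpha>"
  shows "(X0 * N1 + X1 * N0 - (Y0 * M1 + Y1 * M0)) / (Y0 * N0)
     = - (a * b * W / (A1\<^sup>2 * B1)) * (dW / W - (A1 / a - C1 / b))"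
proof -
  define K where "K = X0 * N1 + X1 * N0 - (Y0 * M1 + Y1 * M0)"
  \<comment> \<open>Clearing the denominators of \<open>W\<close> and \<open>dW\<close> makes the
    identity for \<open>K\<close> polynomial.\<close>
  have W': "a * b * W = a * b * (Pp * (a + b) - b1 - b0 * (B - b)) + A1 * B1 * C1"
    using assms(1,2) by (simp add: W algebra_simps)
  have dW': "(a * b)\<^sup>2 * dW = (a * b)\<^sup>2 * (Pp * (A1 - C1) - b0 * C1)
      + ((A2 * B1 * C1 + A1 * B2 * C1 + A1 * B1 * C2) * (a * b)
          - A1 * B1 * C1 * ((A1 - B1) * b + a * (B1 - C1)))"
    using assms(1,2) by (simp add: dW distrib_left)
  \<comment> \<open>Doubling removes the halves from the second Taylor coefficients. The terms in
    \<alpha> cancel because \<open>X0 * N0 = Y0 * M0\<close>.\<close>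
  have "2 * K = 2 * ((a * b)\<^sup>2 * dW - a * b * W * (A1 * b - C1 * a))"
    unfolding K_def W' dW' X0 X1 Y0 Y1 M0 M1 N0 N1
    by (simp add: algebra_simps power2_eq_square)
  then have K: "K = (a * b)\<^sup>2 * dW - a * b * W * (A1 * b - C1 * a)"
    by (subst (asm) mult_left_cancel) simp_all
  show ?thesis
    unfolding K_def[symmetric] unfolding K Y0 N0 using assms(1-5)
    by (simp add: field_simps power2_eq_square)
qed

theorem mainTheorem11:
  fixes u :: "int \<Rightarrow> 'a::real_normed_field \<Rightarrow> 'a"
    and S :: "'a set"
    and \<xi> p a b0 b1 \<alpha>0 \<alpha>1 \<alpha>2 :: 'a
    and Pol :: "'a poly"
  assumes "open S" and "\<xi> \<in> S"
    and smooth: "\<forall>\<nu>\<in>{-1, 0, 1}. \<forall>k. \<forall>\<eta>\<in>S. (deriv ^^ k) (u \<nu>) field_differentiable (at \<eta>)"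
    and Pol: "Pol = g3 \<alpha>0 \<alpha>1 \<alpha>2 \<or>
              Pol = g3 \<alpha>0 \<alpha>1 \<alpha>2 - [:poly (g3 \<alpha>0 \<alpha>1 \<alpha>2) a:]"
    and "u 1 \<xi> \<noteq> u 0 \<xi>" and "u 0 \<xi> \<noteq> u (-1) \<xi>"
    and "deriv (u 1) \<xi> \<noteq> 0" and "deriv (u 0) \<xi> \<noteq> 0"
    and "straight_bracket (poly Pol p) b0 b1 u \<xi> \<noteq> 0"
  shows "(\<forall>n<1. fls_nth (straight_expansion Pol p b0 b1 u \<xi>) n = 0) \<and>
    fls_nth (straight_expansion Pol p b0 b1 u \<xi>) 1 =
      - ((u 1 \<xi> - u 0 \<xi>) * (u 0 \<xi> - u (-1) \<xi>) * straight_bracket (poly Pol p) b0 b1 u \<xi>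
          / ((deriv (u 1) \<xi>)\<^sup>2 * deriv (u 0) \<xi>))
      * (dlog (straight_bracket (poly Pol p) b0 b1 u) \<xi> - straight_rhs u \<xi>) \<and>
    (fls_nth (straight_expansion Pol p b0 b1 u \<xi>) 1 = 0 \<longleftrightarrow>
      dlog (straight_bracket (poly Pol p) b0 b1 u) \<xi> = straight_rhs u \<xi>)"
proof -
  \<comment> \<open>The two choices of \<open>Pol\<close> differ only in the constant coefficient,
    which enters \<open>R\<close> at order three, beyond the orders used below.\<close>
  obtain c0 where c0: "Pol = [:c0, \<alpha>1, \<alpha>2, 1:]"
    using Pol by (auto simp: g3_def)
  define R where "R = Abs_fps (\<lambda>n. if n = 0 then 1 else if n = 1 then \<alpha>2
         else if n = 2 then \<alpha>1 else if n = 3 then c0 else 0)"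
  define Pp where "Pp = poly Pol p"
  define s where "s = (\<lambda>\<nu>. shift_fps (u \<nu>) \<xi>)"
  \<comment> \<open>The exact difference quotient in \<epsilon>. Its linear coefficient comes from
    the quadratic one of \<open>s\<close>, which brings in the second derivatives.\<close>
  define d where "d = (\<lambda>\<nu> i j. fps_shift 1 (s \<nu> i - s \<nu> j))"
  define D where "D = straight_expansion Pol p b0 b1 u \<xi>"
  define X where "X = (s 1 1 - s 0 1) * (s (-1) 1 - s 0 0) * d (-1) 0 (-1)"
  define Y where "Y = d 1 1 0 * (s 0 0 - s 1 (-1)) * (s 0 (-1) - s (-1) (-1))"
  define M where "M = fps_X * ((s 0 0 - s (-1) 1) * (fps_const b0 * s (-1) 0 + fps_const b1)
     + (s 0 1 - s (-1) 1) * (s (-1) 0 - s 0 0) * fps_const Pp) + d 0 1 0 * d (-1) 1 0 * R"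
  define N where "N = fps_X * ((s 1 (-1) - s 0 0) * (fps_const b0 * s 0 (-1) + fps_const b1)
     + (s 1 0 - s 0 0) * (s 0 (-1) - s 1 (-1)) * fps_const Pp) + d 1 0 (-1) * d 0 0 (-1) * R"
  have dd: "fps_to_fls (s \<nu> i) - fps_to_fls (s \<nu> j) = fls_X * fps_to_fls (d \<nu> i j)" for \<nu> i j
    using arg_cong[OF fps_X_mult_shift_diff[of "s \<nu> i" "s \<nu> j"], of fps_to_fls]
    by (simp add: d_def s_def fls_times_fps_to_fls)
  have nth: "fps_nth (s \<nu> i) 0 = u \<nu> \<xi>" "fps_nth (s \<nu> i) (Suc 0) = deriv (u \<nu>) \<xi> * of_int i"
    "fps_nth (d \<nu> i j) 0 = deriv (u \<nu>) \<xi> * (of_int i - of_int j)"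
    "fps_nth (d \<nu> i j) (Suc 0) = (deriv ^^ 2) (u \<nu>) \<xi> * (of_int i ^ 2 - of_int j ^ 2) / 2" 
    for \<nu> i j
    by (simp_all add: s_def d_def field_simps)
  have R0: "fps_nth R 0 = 1" "fps_nth R (Suc 0) = \<alpha>2" by (simp_all add: R_def)
  \<comment> \<open>With a = \<open>u 1 \<xi> - u 0 \<xi>\<close> and b =
    \<open>u 0 \<xi> - u (-1) \<xi>\<close>, these constant terms are
    \<open>- a * b * deriv (u 1) \<xi>\<close> and
    \<open>deriv (u 1) \<xi> * deriv (u 0) \<xi>\<close>.\<close>
  have Y0: "fps_nth Y 0 \<noteq> 0" and N0: "fps_nth N 0 \<noteq> 0"
    using assms(5-8) by (simp_all add: Y_def N_def nth R0)
  have D_eq: "D = C3_defect (fls_const b0) (fls_const b1) (fls_const Pp)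
      (poly (map_poly fls_const Pol) (inverse fls_X)) (\<lambda>\<nu> \<mu>. fps_to_fls (s \<nu> \<mu>))"
    by (simp add: D_def straight_expansion_def shift_series_eq s_def Pp_def)
  have Q: "fls_X ^ 3 * poly (map_poly fls_const Pol) (inverse fls_X) = fps_to_fls R"
    unfolding c0 R_def by (rule cubic_at_inverse_fls_X)
  note hom = fls_times_fps_to_fls
  have "D * (fps_to_fls Y * fps_to_fls N)
      = fps_to_fls X * fps_to_fls N - fps_to_fls Y * fps_to_fls M"
    unfolding D_eq
  proof (rule C3_defect_rescaled[OF _ Q dd dd dd dd dd dd])
    show "fps_to_fls Y \<noteq> 0" "fps_to_fls N \<noteq> 0"
      using Y0 N0 by auto
  qed (simp_all add: X_def Y_def M_def N_def hom)
  then have "D * fps_to_fls (Y * N) = fps_to_fls (X * N - Y * M)"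
    by (simp add: hom)
  then have lead: "(\<forall>n<1. fls_nth D n = 0) \<and>
      fls_nth D 1 = fps_nth (X * N - Y * M) 1 / fps_nth (Y * N) 0"
  proof (rule fls_quotient_leading_coeffs)
    show "fps_nth (Y * N) 0 \<noteq> 0" using Y0 N0 by simp
    \<comment> \<open>Both products have constant term -ab times the product of the three first
      derivatives.\<close>
    show "fps_nth (X * N - Y * M) 0 = 0"
      by (simp add: X_def Y_def M_def N_def nth R0 algebra_simps)
  qed
  have diff: "(deriv ^^ k) (u \<nu>) field_differentiable (at \<xi>)" if "\<nu> \<in> {-1, 0, 1}" for k \<nu>
    using smooth assms(2) that by blast
  define a' where "a' = u 1 \<xi> - u 0 \<xi>"
  define b' where "b' = u 0 \<xi> - u (-1) \<xi>"
  have ab: "a' \<noteq> 0" "b' \<noteq> 0" "u 1 \<xi> - u (-1) \<xi> = a' + b'" "u (-1) \<xi> = u 0 \<xi> - b'"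
    using assms(5,6) by (simp_all add: a'_def b'_def)
  have ab': "u 1 \<xi> = u 0 \<xi> + a'" by (simp add: a'_def)
  have "fps_nth (X * N - Y * M) 1 / fps_nth (Y * N) 0 =
      (fps_nth X 0 * fps_nth N 1 + fps_nth X 1 * fps_nth N 0
        - (fps_nth Y 0 * fps_nth M 1 + fps_nth Y 1 * fps_nth M 0)) / (fps_nth Y 0 * fps_nth N 0)"
    by (simp add: fps_mult_nth_1)
  also have "\<dots> = - (a' * b' * straight_bracket Pp b0 b1 u \<xi> / ((deriv (u 1) \<xi>)\<^sup>2 * deriv (u 0) \<xi>))
      * (deriv (straight_bracket Pp b0 b1 u) \<xi> / straight_bracket Pp b0 b1 u \<xi>
          - (deriv (u 1) \<xi> / a' - deriv (u (-1)) \<xi> / b'))"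
  \<comment> \<open>\<alpha> occurs only in the premises of the identity, so it is instantiated by
    hand.\<close>
  proof (rule leading_coefficient_identity[where \<alpha> = \<alpha>2, OF ab(1,2) assms(7,8)])
    show "straight_bracket Pp b0 b1 u \<xi> \<noteq> 0" using assms(9) by (simp add: Pp_def)
    show "straight_bracket Pp b0 b1 u \<xi> = Pp * (a' + b') - b1 - b0 * (u 0 \<xi> - b')
        + deriv (u 1) \<xi> * deriv (u 0) \<xi> * deriv (u (-1)) \<xi> / (a' * b')"
      unfolding straight_bracket_def by (simp add: a'_def b'_def)
    show "deriv (straight_bracket Pp b0 b1 u) \<xi> =
        Pp * (deriv (u 1) \<xi> - deriv (u (-1)) \<xi>) - b0 * deriv (u (-1)) \<xi>
        + (((deriv ^^ 2) (u 1) \<xi> * deriv (u 0) \<xi> * deriv (u (-1)) \<xi>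
            + deriv (u 1) \<xi> * (deriv ^^ 2) (u 0) \<xi> * deriv (u (-1)) \<xi>
            + deriv (u 1) \<xi> * deriv (u 0) \<xi> * (deriv ^^ 2) (u (-1)) \<xi>) * (a' * b')
          - deriv (u 1) \<xi> * deriv (u 0) \<xi> * deriv (u (-1)) \<xi>
            * ((deriv (u 1) \<xi> - deriv (u 0) \<xi>) * b' + a' * (deriv (u 0) \<xi> - deriv (u (-1)) \<xi>)))
          / (a' * b')\<^sup>2"
      using deriv_straight_bracket[of u \<xi> Pp b0 b1] diff[where k = 0] diff[where k = 1] assms(5,6)
      by (simp add: a'_def b'_def Let_def)
  qed (simp_all add: X_def Y_def M_def N_def nth R0 fps_mult_nth_1 ab' ab(4) field_simps)
  finally have lead1: "fls_nth D 1 =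
      - (a' * b' * straight_bracket Pp b0 b1 u \<xi> / ((deriv (u 1) \<xi>)\<^sup>2 * deriv (u 0) \<xi>))
      * (dlog (straight_bracket Pp b0 b1 u) \<xi> - straight_rhs u \<xi>)"
    using lead by (simp add: dlog_def straight_rhs_def a'_def b'_def)
  \<comment> \<open>The prefactor is nonzero, since the bracket, both differences and both
    derivatives in it are.\<close>
  then have "fls_nth D 1 = 0 \<longleftrightarrow> dlog (straight_bracket Pp b0 b1 u) \<xi> = straight_rhs u \<xi>"
    using assms(7-9) ab(1,2) by (simp add: Pp_def)
  with lead lead1 show ?thesis
    unfolding D_def a'_def b'_def Pp_def by blast
qed

end
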